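(* There exists an absolute constant $c>0$ such that the following holds. For every $\varepsilon>0$ there is $n_0=n_0(\varepsilon)$ such that for every $n\ge n_0$ and every $n$-vertex graph $F$ with maximum degree $\Delta(F)\le(1-\varepsilon)n$ and no isolated vertices, every 2-coloring $f:E(K_n)\to\{\pm1\}$ admits a copy of $F$ in $K_n$ with discrepancy at least $c\cdot\varepsilon n$.
   Context: For a coloring $f:E(K_n)\to\{\pm1\}$ and a subgraph $F_0\subseteq K_n$, the discrepancy of $F_0$ is $\left|\sum_{e\in E(F_0)}f(e)\right|$. A copy of $F$ in $K_n$ is a subgraph of $K_n$ isomorphic to $F$. *)

theory Defs
  imports Complex_Main
begin

definition Kn_edges :: "nat \<Rightarrow> nat set set" where
  "Kn_edges n = {e. e \<subseteq> {0..<n} \<and> card e = 2}"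

text \<open>A graph on vertex set {0..<n} is given by its edge set F, a subset of Kn_edges n.\<close>
definition degree :: "nat set set \<Rightarrow> nat \<Rightarrow> nat" where
  "degree F v = card {e \<in> F. v \<in> e}"

definition copy_edges :: "(nat \<Rightarrow> nat) \<Rightarrow> nat set set \<Rightarrow> nat set set" where
  "copy_edges \<sigma> F = (\<lambda>e. \<sigma> ` e) ` F"

definition discrepancy :: "(nat set \<Rightarrow> int) \<Rightarrow> nat set set \<Rightarrow> int" where
  "discrepancy f H = \<bar>\<Sum>e\<in>H. f e\<bar>"

end

theory Submission
  imports Defs "HOL-Combinatorics.Permutations"
begin

text \<open>
  Suppose every copy has discrepancy less than \<open>K\<close>. Place \<open>F\<close> by a permutation \<open>\<sigma>\<close>, choose
  disjoint pairs of vertices of \<open>F\<close>, and swap the images of some of the pairs. As a function of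
  the signs recording the swaps, the signed edge sum is a polynomial of degree at most two.
  Comparing the copies of a sign vector and of its negative isolates the linear part, so the sum of
  the absolute values of the linear coefficients is \<open>O(K)\<close>.

  The coefficient of a pair of non-twins \<open>p, p'\<close> is large on average over \<open>\<sigma>\<close>: there are
  \<open>w, w'\<close> at which the difference of the adjacency rows of \<open>p\<close> and \<open>p'\<close> takes different values,
  and transposing the images of \<open>w\<close> and \<open>w'\<close> changes the coefficient by a multiple of the
  alternating sum of the colours of the 4-cycle spanned by the images of \<open>p, w, p', w'\<close>. Only
  \<open>w, w'\<close> outside the chosen pairs can be used without cancellation; a random subset of the
  vertices decides which pairs of a maximal pairing are kept. A set of mutual twins has size at
  most \<open>\<Delta>(F) + 1\<close>, so a maximal pairing of non-twins covers about \<open>\<epsilon>n\<close> vertices. Hence \<open>K\<close> is at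
  least of order \<open>\<epsilon>n\<close> times the average absolute alternating sum.

  If that average is below a small constant, then for suitable \<open>a, b, c\<close> the colour of most pairs
  \<open>xy\<close> is \<open>f(ax) + f(ay) - t\<close> with \<open>t = f(ab) + f(ac) - f(bc)\<close>. As the values are \<open>\<plusminus>1\<close>, this makes
  the colouring constant on most pairs, and the mean over all copies is of order \<open>e(F) \<ge> n/2\<close>.
\<close>

section \<open>Averages over permutations, pairings and random subsets\<close>

abbreviation perms :: "'a set \<Rightarrow> ('a \<Rightarrow> 'a) set" where
  "perms V \<equiv> {\<sigma>. \<sigma> permutes V}"

text \<open>Built one entry at a time: following the permutation for the tails by a transposition
  sends the new entry to its target. The earlier targets stay fixed because neither transposed point
  is among them.\<close>

lemma permutes_extend_list:
  assumes "distinct xs" "distinct ys" "length xs = length ys" "set xs \<subseteq> V" "set ys \<subseteq> V"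
  shows "\<exists>\<rho>. \<rho> permutes V \<and> map \<rho> xs = ys"
  using assms(3,1,2,4,5)
proof (induction xs ys rule: list_induct2)
  case Nil
  show ?case by (intro exI[of _ id] conjI permutes_id) simp
next
  case (Cons x xs y ys)
  then obtain \<rho> where \<rho>: "\<rho> permutes V" "map \<rho> xs = ys" by auto
  have inj: "inj \<rho>" using \<rho>(1) by (rule permutes_inj)
  have "\<rho> x \<in> V" "y \<in> V" using Cons.prems permutes_in_image[OF \<rho>(1)] by auto
  then have perm: "transpose (\<rho> x) y \<circ> \<rho> permutes V"
    by (intro permutes_compose[OF \<rho>(1)] permutes_swap_id)
  have "\<rho> x \<notin> set ys"
    using Cons.prems(1) inj \<rho>(2) by (metis distinct.simps(2) inj_image_mem_iff list.set_map)
  moreover have "y \<notin> set ys" using Cons.prems by simp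
  ultimately have "map (transpose (\<rho> x) y \<circ> \<rho>) xs = ys"
    using \<rho>(2) by (metis (no_types, lifting) list.map_comp map_idI transpose_apply_other)
  then show ?case using perm by (metis comp_apply list.simps(9) transpose_apply_first)
qed

lemma sum_perms_compose:
  assumes "\<rho> permutes V"
  shows "(\<Sum>\<sigma>\<in>perms V. g (\<sigma> \<circ> \<rho>)) = (\<Sum>\<sigma>\<in>perms V. g \<sigma>)"
  using sum_permutations_compose_right[OF assms, of g] by simp

text \<open>Right translation by a permutation carrying \<open>ys\<close> to \<open>xs\<close>
  reindexes the sum. So an average over all placements depends only on the number of distinct
  vertices involved, not on which ones they are.\<close>

lemma sum_perms_list_eq:
  fixes g :: "'a list \<Rightarrow> real"
  assumes "distinct xs" "distinct ys" "length xs = length ys" "set xs \<subseteq> V" "set ys \<subseteq> V"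
  shows "(\<Sum>\<sigma>\<in>perms V. g (map \<sigma> xs)) = (\<Sum>\<sigma>\<in>perms V. g (map \<sigma> ys))"
proof -
  obtain \<rho> where \<rho>: "\<rho> permutes V" "map \<rho> ys = xs"
    using permutes_extend_list[of ys xs V] assms by auto
  show ?thesis
    using sum_perms_compose[OF \<rho>(1), of "\<lambda>\<sigma>. g (map \<sigma> ys)"] \<rho>(2)
    by (simp flip: map_map)
qed

lemma involution_permutes:
  assumes "\<And>x. t (t x) = x" "\<And>x. x \<notin> V \<Longrightarrow> t x = x"
  shows "t permutes V"
  unfolding permutes_def using assms by metis

text \<open>A pairing is encoded as an involution \<tau> whose fixed points are the unpaired
  elements; the last clause expresses maximality. The pairing is built greedily, removing one
  \<open>N\<close>-related pair from \<open>V\<close> at each step.\<close>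

lemma maximal_pairing:
  fixes N :: "'a \<Rightarrow> 'a \<Rightarrow> bool"
  assumes "finite V" and sym: "\<And>u v. N u v \<Longrightarrow> N v u"
  shows "\<exists>\<tau>. \<tau> permutes V \<and> (\<forall>x. \<tau> (\<tau> x) = x) \<and> (\<forall>p. \<tau> p \<noteq> p \<longrightarrow> N p (\<tau> p)) \<and>
     (\<forall>u\<in>V. \<forall>v\<in>V. u \<noteq> v \<longrightarrow> \<tau> u = u \<longrightarrow> \<tau> v = v \<longrightarrow> \<not> N u v)"
  using assms(1)
proof (induction V rule: finite_psubset_induct)
  case (psubset V)
  show ?case
  proof (cases "\<exists>u\<in>V. \<exists>v\<in>V. u \<noteq> v \<and> N u v")
    case False
    then show ?thesis by (intro exI[of _ id] conjI permutes_id) auto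
  next
    case True
    then obtain u v where uv: "u \<in> V" "v \<in> V" "u \<noteq> v" "N u v" by auto
    then have "V - {u,v} \<subset> V" by auto
    from psubset.IH[OF this] obtain \<tau> where
      \<tau>: "\<tau> permutes V - {u,v}" "\<And>x. \<tau> (\<tau> x) = x" "\<And>p. \<tau> p \<noteq> p \<Longrightarrow> N p (\<tau> p)"
      "\<And>x y. x \<in> V - {u,v} \<Longrightarrow> y \<in> V - {u,v} \<Longrightarrow> x \<noteq> y \<Longrightarrow> \<tau> x = x \<Longrightarrow> \<tau> y = y \<Longrightarrow> \<not> N x y"
      by blast
    define t where "t x = (if x = u then v else if x = v then u else \<tau> x)" for x
    have fix_uv: "\<tau> u = u" "\<tau> v = v" using \<tau>(1) by (auto intro: permutes_not_in)
    then have ne: "\<tau> x \<noteq> u" "\<tau> x \<noteq> v" if "x \<noteq> u" "x \<noteq> v" for x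
      using \<tau>(2) that by metis+
    have tt: "t (t x) = x" for x unfolding t_def using ne \<tau>(2) by auto
    have "t permutes V"
      by (rule involution_permutes[OF tt]) (use uv \<tau>(1) permutes_not_in in \<open>fastforce simp: t_def\<close>)
    moreover have "N p (t p)" if "t p \<noteq> p" for p
      using that uv sym \<tau>(3) unfolding t_def by (auto split: if_splits)
    moreover have "\<not> N x y" if "x \<in> V" "y \<in> V" "x \<noteq> y" "t x = x" "t y = y" for x y
      using that \<tau>(4)[of x y] uv(3) unfolding t_def by (auto split: if_splits)
    ultimately show ?thesis using tt by blast
  qed
qed

text \<open>A uniformly random subset of \<open>V\<close> works with probability at least 1/16 for each \<open>p\<close>.\<close>
lemma exists_splitting_subset:
  fixes a b c d :: "'a \<Rightarrow> 'a"
  assumes "finite V" "P \<subseteq> V"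
    and "\<And>p. p \<in> P \<Longrightarrow> {a p, b p, c p, d p} \<subseteq> V \<and> {a p, b p} \<inter> {c p, d p} = {}"
  shows "\<exists>X\<subseteq>V. card P \<le> 16 * card {p\<in>P. a p \<in> X \<and> b p \<in> X \<and> c p \<notin> X \<and> d p \<notin> X}"
proof (rule ccontr)
  assume neg: "\<not> ?thesis"
  define good where "good p X \<longleftrightarrow> a p \<in> X \<and> b p \<in> X \<and> c p \<notin> X \<and> d p \<notin> X" for p X
  have finP: "finite P" using assms finite_subset by blast
  have many: "2 ^ card V \<le> 16 * card {X\<in>Pow V. good p X}" if "p \<in> P" for p
  proof -
    let ?Y = "{a p, b p, c p, d p}"
    have Y: "?Y \<subseteq> V" "{a p, b p} \<inter> {c p, d p} = {}" using assms(3) that by auto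
    have "card ?Y \<le> 4" by (auto intro: order_trans[OF card_insert_le_m1] simp: card_insert_if)
    then have "card V \<le> card (V - ?Y) + 4"
      using Y(1) assms(1) by (simp add: card_Diff_subset finite_subset)
    then have "(2::nat) ^ card V \<le> 2 ^ (card (V - ?Y) + 4)" by (intro power_increasing) auto
    also have "\<dots> = 16 * card (Pow (V - ?Y))" using assms(1) by (simp add: card_Pow power_add)
    \<comment> \<open>A set is good as soon as its trace on \<open>?Y\<close> is exactly
      \<open>{a p, b p}\<close>; its trace outside \<open>?Y\<close> is then free.\<close>
    also have "card (Pow (V - ?Y)) = card ((\<lambda>X. X \<union> {a p, b p}) ` Pow (V - ?Y))"
      by (intro card_image[symmetric] inj_onI) blast
    also have "\<dots> \<le> card {X\<in>Pow V. good p X}"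
      using Y by (intro card_mono) (auto simp: good_def assms(1))
    finally show ?thesis by simp
  qed
  \<comment> \<open>Double counting of the good pairs \<open>(p, X)\<close>: if every
    \<open>X\<close> were good for fewer than \<open>card P / 16\<close> elements, the total would
    be too small.\<close>
  have "card P * 2 ^ card V = (\<Sum>p\<in>P. 2 ^ card V)" by simp
  also have "\<dots> \<le> (\<Sum>p\<in>P. 16 * card {X\<in>Pow V. good p X})" by (intro sum_mono many)
  also have "\<dots> = 16 * (\<Sum>p\<in>P. \<Sum>X\<in>Pow V. of_bool (good p X))"
    using assms(1) by (simp add: sum_distrib_left Int_def)
  also have "\<dots> = (\<Sum>X\<in>Pow V. 16 * (\<Sum>p\<in>P. of_bool (good p X)))"
    by (subst sum.swap) (simp add: sum_distrib_left)
  also have "\<dots> = (\<Sum>X\<in>Pow V. 16 * card {p\<in>P. good p X})"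
    using finP by (simp add: Int_def)
  also have "\<dots> < (\<Sum>X\<in>Pow V. card P)"
    using neg assms(1) by (intro sum_strict_mono) (auto simp: good_def not_le)
  also have "\<dots> = card P * 2 ^ card V" using assms(1) by (simp add: card_Pow)
  finally show False by simp
qed

section \<open>The signed edge sum under swaps and its linear coefficients\<close>

text \<open>For symmetric \<open>A\<close> and \<open>B\<close> every edge is counted twice, once for each orientation.\<close>
definition signed_form :: "'a set \<Rightarrow> ('a \<Rightarrow> 'a \<Rightarrow> real) \<Rightarrow> ('a \<Rightarrow> 'a \<Rightarrow> real) \<Rightarrow> ('a \<Rightarrow> 'a) \<Rightarrow> real" where
  "signed_form V A B \<sigma> = (\<Sum>p\<in>V. \<Sum>q\<in>V. A p q * B (\<sigma> p) (\<sigma> q))"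

text \<open>With independent choices of which pairs \<open>{p, \<tau> p}\<close> get swapped, \<open>swap_coeff\<close> is, up to a constant,
  the coefficient of the sign of the pair of \<open>p\<close> in the resulting polynomial of degree at most two
  in the signs.\<close>
definition swap_coeff ::
  "'a set \<Rightarrow> ('a \<Rightarrow> 'a \<Rightarrow> real) \<Rightarrow> ('a \<Rightarrow> 'a \<Rightarrow> real) \<Rightarrow> ('a \<Rightarrow> 'a) \<Rightarrow> ('a \<Rightarrow> 'a) \<Rightarrow> 'a \<Rightarrow> real" where
  "swap_coeff V A B \<tau> \<sigma> p = (\<Sum>q\<in>V. (A p q - A (\<tau> p) q) *
     ((B (\<sigma> p) (\<sigma> q) + B (\<sigma> p) (\<sigma> (\<tau> q))) - (B (\<sigma> (\<tau> p)) (\<sigma> q) + B (\<sigma> (\<tau> p)) (\<sigma> (\<tau> q)))))"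

text \<open>The alternating sum around the 4-cycle x, z, y, w, in which x, y and z, w are the
  opposite pairs.\<close>

definition alt4 :: "('a \<Rightarrow> 'a \<Rightarrow> real) \<Rightarrow> 'a \<Rightarrow> 'a \<Rightarrow> 'a \<Rightarrow> 'a \<Rightarrow> real" where
  "alt4 B x y z w = B x z - B y z - B x w + B y w"

text \<open>Here \<pi> is \<sigma> with some pairs swapped, and \<open>\<pi> \<circ> \<tau>\<close>
  swaps exactly the other pairs, which negates all signs. Terms of even degree in the signs cancel
  in the difference, and the linear part remains.\<close>

lemma form_odd_part:
  assumes A: "\<And>p q. A p q = A q p" and B: "\<And>x y. B x y = B y x"
    and \<tau>: "\<tau> permutes V" and inv: "\<And>x. \<tau> (\<tau> x) = x"
    and pi: "\<And>p. (\<pi> p = \<sigma> p \<and> \<pi> (\<tau> p) = \<sigma> (\<tau> p)) \<or> (\<pi> p = \<sigma> (\<tau> p) \<and> \<pi> (\<tau> p) = \<sigma> p)"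
  shows "signed_form V A B \<pi> - signed_form V A B (\<pi> \<circ> \<tau>) = (\<Sum>p\<in>V. \<Sum>q\<in>V. (A p q - A (\<tau> p) q) *
     ((B (\<pi> p) (\<sigma> q) + B (\<pi> p) (\<sigma> (\<tau> q))) - (B (\<pi> (\<tau> p)) (\<sigma> q) + B (\<pi> (\<tau> p)) (\<sigma> (\<tau> q))))) / 2"
proof -
  define X where "X p q = B (\<pi> p) (\<pi> q)" for p q
  define G where "G x q = B x (\<sigma> q) + B x (\<sigma> (\<tau> q))" for x q
  \<comment> \<open>\<open>G\<close> sums over both members of the pair of \<open>q\<close>, so it
    does not notice whether that pair is swapped.\<close>
  have G: "G x q = B x (\<pi> q) + B x (\<pi> (\<tau> q))" for x q
    using pi[of q] unfolding G_def by auto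
  \<comment> \<open>With this identity the two mixed sums in the expansion below cancel; it rests on
    the symmetry of both \<open>A\<close> and \<open>B\<close>.\<close>
  have swap: "(\<Sum>p\<in>V. \<Sum>q\<in>V. A p q * X p (\<tau> q)) = (\<Sum>p\<in>V. \<Sum>q\<in>V. A p q * X (\<tau> p) q)"
    by (subst sum.swap) (simp add: X_def A B)
  have shift: "(\<Sum>p\<in>V. \<Sum>q\<in>V. A (\<tau> p) q * (G (\<pi> p) q - G (\<pi> (\<tau> p)) q))
      = (\<Sum>p\<in>V. \<Sum>q\<in>V. A p q * (G (\<pi> (\<tau> p)) q - G (\<pi> p) q))"
    using sum.permute[OF \<tau>, of "\<lambda>p. \<Sum>q\<in>V. A p q * (G (\<pi> (\<tau> p)) q - G (\<pi> p) q)"]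
    by (simp add: inv o_def)
  have "(\<Sum>p\<in>V. \<Sum>q\<in>V. (A p q - A (\<tau> p) q) * (G (\<pi> p) q - G (\<pi> (\<tau> p)) q))
    = (\<Sum>p\<in>V. \<Sum>q\<in>V. A p q * (G (\<pi> p) q - G (\<pi> (\<tau> p)) q))
      - (\<Sum>p\<in>V. \<Sum>q\<in>V. A (\<tau> p) q * (G (\<pi> p) q - G (\<pi> (\<tau> p)) q))"
    by (simp add: left_diff_distrib sum_subtractf)
  also have "\<dots> = 2 * (\<Sum>p\<in>V. \<Sum>q\<in>V. A p q * (G (\<pi> p) q - G (\<pi> (\<tau> p)) q))"
    unfolding shift by (simp add: right_diff_distrib sum_subtractf)
  also have "(\<Sum>p\<in>V. \<Sum>q\<in>V. A p q * (G (\<pi> p) q - G (\<pi> (\<tau> p)) q))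
    = (\<Sum>p\<in>V. \<Sum>q\<in>V. A p q * X p q) + (\<Sum>p\<in>V. \<Sum>q\<in>V. A p q * X p (\<tau> q))
      - (\<Sum>p\<in>V. \<Sum>q\<in>V. A p q * X (\<tau> p) q) - (\<Sum>p\<in>V. \<Sum>q\<in>V. A p q * X (\<tau> p) (\<tau> q))"
    by (simp add: G X_def algebra_simps sum.distrib sum_subtractf)
  also have "\<dots> = signed_form V A B \<pi> - signed_form V A B (\<pi> \<circ> \<tau>)"
    unfolding swap by (simp add: signed_form_def X_def)
  finally show ?thesis by (simp add: G_def)
qed

text \<open>Choosing each sign to agree with its coefficient turns the linear part into half the sum
  of the absolute values. It is a difference of two forms bounded by \<open>K\<close>, hence the
  factor 4.\<close>

lemma sum_swap_coeff_le:
  assumes A: "\<And>p q. A p q = A q p" and B: "\<And>x y. B x y = B y x"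
    and \<tau>: "\<tau> permutes V" and inv: "\<And>x. \<tau> (\<tau> x) = x" and \<sigma>: "\<sigma> permutes V"
    and bound: "\<And>\<pi>. \<pi> permutes V \<Longrightarrow> \<bar>signed_form V A B \<pi>\<bar> \<le> K"
  shows "(\<Sum>p\<in>V. \<bar>swap_coeff V A B \<tau> \<sigma> p\<bar>) \<le> 4 * K"
proof -
  define c where "c = swap_coeff V A B \<tau> \<sigma>"
  \<comment> \<open>Swaps the pairs with negative coefficient. As \<open>c\<close> is constant on
    pairs, this is again an involution.\<close>
  define t where "t p = (if c p < 0 then \<tau> p else p)" for p
  have c_inv: "c (\<tau> p) = c p" for p
    unfolding c_def swap_coeff_def by (intro sum.cong) (auto simp: inv algebra_simps)
  have tt: "t (t x) = x" for x by (simp add: t_def c_inv inv)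
  have t: "t permutes V"
    by (rule involution_permutes[OF tt]) (simp add: t_def permutes_not_in[OF \<tau>])
  define \<pi> where "\<pi> = \<sigma> \<circ> t"
  have \<pi>: "\<pi> permutes V" unfolding \<pi>_def using t \<sigma> by (rule permutes_compose)
  have abs_c: "\<bar>c p\<bar> = (\<Sum>q\<in>V. (A p q - A (\<tau> p) q) *
     ((B (\<pi> p) (\<sigma> q) + B (\<pi> p) (\<sigma> (\<tau> q))) - (B (\<pi> (\<tau> p)) (\<sigma> q) + B (\<pi> (\<tau> p)) (\<sigma> (\<tau> q)))))" for p
  proof (cases "c p < 0")
    case True
    then have "\<pi> p = \<sigma> (\<tau> p)" "\<pi> (\<tau> p) = \<sigma> p" by (simp_all add: \<pi>_def t_def c_inv inv)
    with True show ?thesis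
      by (simp add: c_def swap_coeff_def flip: sum_negf) (auto intro!: sum.cong simp: algebra_simps)
  next
    case False
    then have "\<pi> p = \<sigma> p" "\<pi> (\<tau> p) = \<sigma> (\<tau> p)" by (simp_all add: \<pi>_def t_def c_inv)
    with False show ?thesis by (simp add: c_def swap_coeff_def)
  qed
  have "signed_form V A B \<pi> - signed_form V A B (\<pi> \<circ> \<tau>) = (\<Sum>p\<in>V. \<bar>c p\<bar>) / 2"
    unfolding abs_c
    by (rule form_odd_part[OF A B \<tau> inv]) (auto simp: \<pi>_def t_def c_inv inv)
  moreover have "\<bar>signed_form V A B \<pi>\<bar> \<le> K" "\<bar>signed_form V A B (\<pi> \<circ> \<tau>)\<bar> \<le> K"
    using \<pi> \<tau> by (auto intro!: bound permutes_compose)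
  ultimately show ?thesis by (simp add: c_def)
qed

text \<open>Since \<open>w\<close> and \<open>w'\<close> are unpaired, only the terms
  \<open>q = w\<close> and \<open>q = w'\<close> change. The factor 2 arises because
  \<open>q\<close> and \<open>\<tau> q\<close> coincide there and contribute equally.\<close>

lemma swap_coeff_transpose:
  assumes fin: "finite V" and \<tau>: "\<And>x. \<tau> (\<tau> x) = x" and w: "\<tau> w = w" "\<tau> w' = w'" "w \<noteq> w'" "w \<in> V" "w' \<in> V"
    and p: "p \<notin> {w, w'}"
  shows "swap_coeff V A B \<tau> \<sigma> p - swap_coeff V A B \<tau> (\<sigma> \<circ> transpose w w') p =
    2 * ((A p w - A (\<tau> p) w) - (A p w' - A (\<tau> p) w')) * alt4 B (\<sigma> p) (\<sigma> (\<tau> p)) (\<sigma> w) (\<sigma> w')"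
proof -
  define \<delta> where "\<delta> q = A p q - A (\<tau> p) q" for q
  define \<gamma> where "\<gamma> z = B (\<sigma> p) z - B (\<sigma> (\<tau> p)) z" for z
  define s where "s = transpose w w'"
  have ne: "\<tau> q \<noteq> w" "\<tau> q \<noteq> w'" if "q \<noteq> w" "q \<noteq> w'" for q using that w \<tau> by metis+
  have "p \<noteq> w" "p \<noteq> w'" using p by auto
  then have sp: "s p = p" "s (\<tau> p) = \<tau> p"
    unfolding s_def using ne[of p] by (simp_all add: transpose_apply_other)
  have "swap_coeff V A B \<tau> \<sigma> p - swap_coeff V A B \<tau> (\<sigma> \<circ> s) p =
     (\<Sum>q\<in>V. \<delta> q * ((\<gamma> (\<sigma> q) - \<gamma> (\<sigma> (s q))) + (\<gamma> (\<sigma> (\<tau> q)) - \<gamma> (\<sigma> (s (\<tau> q))))))"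
    unfolding swap_coeff_def sum_subtractf[symmetric]
    by (intro sum.cong) (auto simp: \<delta>_def \<gamma>_def sp algebra_simps)
  also have "\<dots> = (\<Sum>q\<in>{w,w'}. \<delta> q * ((\<gamma> (\<sigma> q) - \<gamma> (\<sigma> (s q))) + (\<gamma> (\<sigma> (\<tau> q)) - \<gamma> (\<sigma> (s (\<tau> q))))))"
    by (rule sum.mono_neutral_right[OF fin]) (use w ne in \<open>auto simp: s_def\<close>)
  also have "\<dots> = 2 * (\<delta> w - \<delta> w') * (\<gamma> (\<sigma> w) - \<gamma> (\<sigma> w'))"
    using w by (simp add: s_def algebra_simps)
  finally show ?thesis by (simp add: s_def \<delta>_def \<gamma>_def alt4_def)
qed

text \<open>The coefficients at \<sigma> and at \<open>\<sigma> \<circ> transpose w w'\<close>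
  differ by at least twice the alternating sum in absolute value, while their absolute values have
  the same average. The vertices \<open>a, b, c, d\<close> only serve as a common reference
  quadruple.\<close>

lemma sum_perms_swap_coeff_ge:
  assumes fin: "finite V" and \<tau>: "\<tau> permutes V" "\<And>x. \<tau> (\<tau> x) = x"
    and w: "\<tau> w = w" "\<tau> w' = w'" "w \<in> V" "w' \<in> V"
    and p: "\<tau> p \<noteq> p"
    and gap: "\<bar>(A p w - A (\<tau> p) w) - (A p w' - A (\<tau> p) w')\<bar> \<ge> 1"
    and abcd: "distinct [a, b, c, d]" "{a, b, c, d} \<subseteq> V"
  shows "(\<Sum>\<sigma>\<in>perms V. \<bar>alt4 B (\<sigma> a) (\<sigma> b) (\<sigma> c) (\<sigma> d)\<bar>) \<le> (\<Sum>\<sigma>\<in>perms V. \<bar>swap_coeff V A B \<tau> \<sigma> p\<bar>)"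
proof -
  have "w \<noteq> w'" using gap by auto
  have pne: "p \<notin> {w, w'}" using p w by auto
  have pV: "p \<in> V" "\<tau> p \<in> V" using p \<tau>(1) by (metis permutes_not_in permutes_in_image)+
  have dist: "distinct [p, \<tau> p, w, w']" using p pne \<open>w \<noteq> w'\<close> w \<tau>(2)[of p] by auto
  have tr: "transpose w w' permutes V" using w by (intro permutes_swap_id)
  have "(\<Sum>\<sigma>\<in>perms V. \<bar>alt4 B (\<sigma> a) (\<sigma> b) (\<sigma> c) (\<sigma> d)\<bar>)
      = (\<Sum>\<sigma>\<in>perms V. \<bar>alt4 B (\<sigma> p) (\<sigma> (\<tau> p)) (\<sigma> w) (\<sigma> w')\<bar>)"
    using sum_perms_list_eq[of "[a,b,c,d]" "[p, \<tau> p, w, w']" V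
      "\<lambda>l. \<bar>alt4 B (l!0) (l!1) (l!2) (l!3)\<bar>"] abcd dist pV w
    by (simp add: numeral_2_eq_2 numeral_3_eq_3)
  moreover have "2 * (\<Sum>\<sigma>\<in>perms V. \<bar>alt4 B (\<sigma> p) (\<sigma> (\<tau> p)) (\<sigma> w) (\<sigma> w')\<bar>)
    \<le> (\<Sum>\<sigma>\<in>perms V. \<bar>swap_coeff V A B \<tau> \<sigma> p\<bar> + \<bar>swap_coeff V A B \<tau> (\<sigma> \<circ> transpose w w') p\<bar>)"
    unfolding sum_distrib_left
  proof (intro sum_mono)
    fix \<sigma>
    let ?g = "(A p w - A (\<tau> p) w) - (A p w' - A (\<tau> p) w')"
    let ?a = "alt4 B (\<sigma> p) (\<sigma> (\<tau> p)) (\<sigma> w) (\<sigma> w')"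
    have "1 * \<bar>?a\<bar> \<le> \<bar>?g\<bar> * \<bar>?a\<bar>" using gap by (intro mult_right_mono) auto
    then have "2 * \<bar>?a\<bar> \<le> \<bar>2 * ?g * ?a\<bar>"
      unfolding abs_mult mult.assoc abs_numeral by linarith
    also have "2 * ?g * ?a = swap_coeff V A B \<tau> \<sigma> p - swap_coeff V A B \<tau> (\<sigma> \<circ> transpose w w') p"
      using swap_coeff_transpose[OF fin \<tau>(2) w(1,2) \<open>w \<noteq> w'\<close> w(3,4) pne, of A B \<sigma>] by simp
    also have "\<bar>\<dots>\<bar> \<le> \<bar>swap_coeff V A B \<tau> \<sigma> p\<bar> + \<bar>swap_coeff V A B \<tau> (\<sigma> \<circ> transpose w w') p\<bar>"
      by linarith
    finally show "2 * \<bar>?a\<bar> \<le> \<dots>" .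
  qed
  moreover have "(\<Sum>\<sigma>\<in>perms V. \<bar>swap_coeff V A B \<tau> (\<sigma> \<circ> transpose w w') p\<bar>)
      = (\<Sum>\<sigma>\<in>perms V. \<bar>swap_coeff V A B \<tau> \<sigma> p\<bar>)"
    by (rule sum_perms_compose[OF tr])
  ultimately show ?thesis by (simp add: sum.distrib)
qed

section \<open>Colourings with small alternating sums are nearly constant\<close>

text \<open>If both alternating sums vanish at \<open>(x, y)\<close>, then
  \<open>B x y = B a x + B a y - t\<close>. Since all values are 1 or -1, this forbids
  \<open>B a x\<close> and \<open>B a y\<close> both having the sign opposite to t, and fixes
  \<open>B x y\<close> when both have the sign of t.\<close>

lemma nearly_constant:
  assumes fin: "finite V" and large: "card V \<ge> 200"
    and B: "\<And>x y. B x y = B y x"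
    and diag: "\<And>x. B x x = 0"
    and pm: "\<And>x y. x \<in> V \<Longrightarrow> y \<in> V \<Longrightarrow> x \<noteq> y \<Longrightarrow> B x y = 1 \<or> B x y = (-1::real)"
    and abc: "distinct [a, b, c]" "{a, b, c} \<subseteq> V"
    and few: "real (card {(x, y). x \<in> V - {a,b,c} \<and> y \<in> V - {a,b,c} \<and> x \<noteq> y \<and>
        (alt4 B x b y a \<noteq> 0 \<or> alt4 B b a y c \<noteq> 0)}) \<le> (real (card V))\<^sup>2 / 200"
  shows "(real (card V))\<^sup>2 / 2 \<le> \<bar>\<Sum>x\<in>V. \<Sum>y\<in>V. B x y\<bar>"
proof -
  let ?n = "real (card V)"
  define E where "E = {(x, y). x \<in> V - {a,b,c} \<and> y \<in> V - {a,b,c} \<and> x \<noteq> y \<and>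
    (alt4 B x b y a \<noteq> 0 \<or> alt4 B b a y c \<noteq> 0)}"
  have few: "real (card E) \<le> ?n\<^sup>2 / 200" using few by (simp only: E_def)
  define W where "W = V - {a, b, c}"
  define t where "t = B a b + B a c - B b c"
  have "t \<in> {3, 1, -1, -3}"
    using pm[of a b] pm[of a c] pm[of b c] abc by (auto simp: t_def)
  \<comment> \<open>\<open>s\<close> is the sign of \<open>t\<close>, and \<open>r\<close> is
    \<open>2 * s - t\<close>, the colour of an unexceptional pair outside \<open>N\<close>.\<close>
  then obtain s r :: real where sr: "s \<in> {1, -1}" "(t = s \<and> r = s) \<or> (t = 3 * s \<and> r = - s)" by force
  define N where "N = {x\<in>W. B a x = - s}"
  have finE: "finite E" by (rule finite_subset[of _ "V \<times> V"]) (use fin in \<open>auto simp: E_def\<close>)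
  have finN: "finite N" using fin by (simp add: N_def W_def)
  have good: "(x \<notin> N \<or> y \<notin> N) \<and> (x \<in> N \<or> y \<in> N \<or> B x y = r)"
    if xy: "x \<in> W" "y \<in> W" "x \<noteq> y" "(x, y) \<notin> E" for x y
  proof -
    have "alt4 B x b y a = 0" "alt4 B b a y c = 0" using xy by (auto simp: W_def E_def)
    then have "B x y = B a x + B a y - t"
      using B[of b a] B[of x a] by (simp add: alt4_def t_def)
    moreover have "B a x = 1 \<or> B a x = -1" "B a y = 1 \<or> B a y = -1" "B x y = 1 \<or> B x y = -1"
      using xy abc pm[of a x] pm[of a y] pm[of x y] by (auto simp: W_def)
    ultimately show ?thesis using sr xy by (auto simp: N_def)
  qed
  \<comment> \<open>All off-diagonal pairs inside \<open>N\<close> are exceptional, so a larger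
    \<open>N\<close> would give more than n^2/200 of them.\<close>
  have cardN: "real (card N) \<le> ?n / 10"
  proof (rule ccontr)
    assume neg: "\<not> ?thesis"
    have "N \<times> N - (\<lambda>x. (x, x)) ` N \<subseteq> E" using good by (auto simp: N_def)
    then have "card (N \<times> N - (\<lambda>x. (x, x)) ` N) \<le> card E" by (rule card_mono[OF finE])
    moreover have "card ((\<lambda>x. (x, x)) ` N) = card N"
      by (simp add: card_image inj_on_def)
    moreover have "(\<lambda>x. (x, x)) ` N \<subseteq> N \<times> N" by auto
    ultimately have "card N * card N - card N \<le> card E"
      using finN by (simp only: card_Diff_subset finite_imageI card_cartesian_product)
    then have "real (card N * card N) - card N \<le> card E" by linarith
    then have "real (card N) * (real (card N) - 1) \<le> ?n\<^sup>2 / 200"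
      using few by (simp add: algebra_simps)
    moreover have "?n / 10 * (?n / 20) < real (card N) * (real (card N) - 1)"
      using neg large by (intro mult_strict_mono) auto
    ultimately show False by (simp add: power2_eq_square)
  qed
  define Z where "Z = {(x, y)\<in>V \<times> V. B x y \<noteq> r}"
  have "Z \<subseteq> E \<union> (N \<times> V \<union> V \<times> N) \<union> ({a,b,c} \<times> V \<union> V \<times> {a,b,c}) \<union> (\<lambda>x. (x, x)) ` V"
    using good by (auto simp: Z_def W_def)
  then have "card Z \<le> card (E \<union> (N \<times> V \<union> V \<times> N) \<union> ({a,b,c} \<times> V \<union> V \<times> {a,b,c}) \<union> (\<lambda>x. (x, x)) ` V)"
    using fin finE finN by (intro card_mono) auto
  also have "\<dots> \<le> card E + (card (N \<times> V) + card (V \<times> N)) + (card ({a,b,c} \<times> V) + card (V \<times> {a,b,c})) + card ((\<lambda>x. (x, x)) ` V)"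
    by (intro order_trans[OF card_Un_le] add_mono order.refl)
  also have "card ((\<lambda>x. (x, x)) ` V) = card V"
    by (simp add: card_image inj_on_def)
  finally have "card Z \<le> card E + 2 * (card N * card V) + 7 * card V"
    using abc by (simp add: card_cartesian_product mult.commute[of "card V"])
  then have "real (card Z) \<le> real (card E + 2 * (card N * card V) + 7 * card V)"
    by (rule of_nat_mono)
  also have "\<dots> = card E + 2 * (real (card N) * ?n) + 7 * ?n"
    by (simp only: of_nat_add of_nat_mult of_nat_numeral)
  \<comment> \<open>The term 7n counts the pairs meeting a, b or c (6n) and the diagonal (n). As n
    is at least 200, the total is at most 0.24 n^2.\<close>
  also have "\<dots> \<le> ?n\<^sup>2 / 200 + 2 * (?n / 10 * ?n) + 7 * ?n"
    using few cardN by (intro add_mono mult_left_mono mult_right_mono) auto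
  also have "7 * ?n \<le> 7 * (?n\<^sup>2 / 200)" using large by (simp add: power2_eq_square)
  finally have Z: "real (card Z) \<le> ?n\<^sup>2 / 4" by (simp add: power2_eq_square)
  have "V \<times> V \<inter> Z = Z" by (auto simp: Z_def)
  then have "?n\<^sup>2 - 2 * card Z = (\<Sum>e\<in>V \<times> V. 1 - 2 * of_bool (e \<in> Z))"
    using fin by (simp add: sum_subtractf card_cartesian_product power2_eq_square flip: sum_distrib_left)
  also have "\<dots> \<le> (\<Sum>(x,y)\<in>V \<times> V. r * B x y)"
  proof (intro sum_mono, clarify)
    fix x y assume "x \<in> V" "y \<in> V"
    then show "1 - 2 * of_bool ((x, y) \<in> Z) \<le> r * B x y"
      using sr pm[of x y] diag[of x] by (cases "x = y") (auto simp: Z_def)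
  qed
  also have "\<dots> = r * (\<Sum>x\<in>V. \<Sum>y\<in>V. B x y)"
    by (simp add: sum.cartesian_product[symmetric] sum_distrib_left)
  also have "\<dots> \<le> \<bar>r * (\<Sum>x\<in>V. \<Sum>y\<in>V. B x y)\<bar>" by simp
  also have "\<dots> = \<bar>\<Sum>x\<in>V. \<Sum>y\<in>V. B x y\<bar>" using sr by (auto simp: abs_mult)
  finally show ?thesis using Z by simp
qed

text \<open>When the mean is small, \<open>nearly_constant\<close> applied at the images of a, b, c
  gives at least n^2/200 bad pairs for every \<sigma>. Each bad pair has a nonzero alternating sum,
  and summing over \<sigma> gives n! n^2/200 \<le> 2 n^2 \<open>D\<close>.\<close>

lemma alt4_or_mean_large:
  assumes fin: "finite V" and large: "card V \<ge> 200"
    and B: "\<And>x y. B x y = B y x"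
    and diag: "\<And>x. B x x = 0"
    and pm: "\<And>x y. x \<in> V \<Longrightarrow> y \<in> V \<Longrightarrow> x \<noteq> y \<Longrightarrow> B x y = 1 \<or> B x y = (-1::real)"
    and wxyz: "distinct [w, x, y, z]" "{w, x, y, z} \<subseteq> V"
  shows "fact (card V) / 400 \<le> (\<Sum>\<sigma>\<in>perms V. \<bar>alt4 B (\<sigma> w) (\<sigma> x) (\<sigma> y) (\<sigma> z)\<bar>) \<or>
    (real (card V))\<^sup>2 / 2 \<le> \<bar>\<Sum>x\<in>V. \<Sum>y\<in>V. B x y\<bar>"
proof (rule disjCI)
  assume small_mean: "\<not> (real (card V))\<^sup>2 / 2 \<le> \<bar>\<Sum>x\<in>V. \<Sum>y\<in>V. B x y\<bar>"
  let ?n = "real (card V)"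
  define D where "D = (\<Sum>\<sigma>\<in>perms V. \<bar>alt4 B (\<sigma> w) (\<sigma> x) (\<sigma> y) (\<sigma> z)\<bar>)"
  have D: "(\<Sum>\<sigma>\<in>perms V. \<bar>alt4 B (\<sigma> p) (\<sigma> q) (\<sigma> u) (\<sigma> v)\<bar>) = D"
    if "distinct [p, q, u, v]" "{p, q, u, v} \<subseteq> V" for p q u v
    unfolding D_def using sum_perms_list_eq[of "[p,q,u,v]" "[w,x,y,z]" V
      "\<lambda>l. \<bar>alt4 B (l!0) (l!1) (l!2) (l!3)\<bar>"] that wxyz
    by (simp add: numeral_2_eq_2 numeral_3_eq_3)
  obtain a b c where abc: "distinct [a, b, c]" "{a, b, c} \<subseteq> V" using wxyz by auto
  define P where "P = {(i, j). i \<in> V - {a,b,c} \<and> j \<in> V - {a,b,c} \<and> i \<noteq> j}"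
  have P: "P \<subseteq> V \<times> V" by (auto simp: P_def)
  have finP: "finite P" using P fin finite_subset by blast
  define bad where "bad \<sigma> i j \<longleftrightarrow>
    alt4 B (\<sigma> i) (\<sigma> b) (\<sigma> j) (\<sigma> a) \<noteq> 0 \<or> alt4 B (\<sigma> b) (\<sigma> a) (\<sigma> j) (\<sigma> c) \<noteq> (0::real)" for \<sigma> i j
  \<comment> \<open>A nonzero alternating sum of four values 1 or -1 is a nonzero integer.\<close>
  have one_le: "1 \<le> \<bar>alt4 B (\<sigma> p) (\<sigma> q) (\<sigma> u) (\<sigma> v)\<bar>"
    if "distinct [p, q, u, v]" "{p, q, u, v} \<subseteq> V" "\<sigma> permutes V"
      "alt4 B (\<sigma> p) (\<sigma> q) (\<sigma> u) (\<sigma> v) \<noteq> 0" for p q u v \<sigma>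
  proof -
    have "B (\<sigma> g) (\<sigma> h) = 1 \<or> B (\<sigma> g) (\<sigma> h) = -1"
      if "g \<in> {p,q,u,v}" "h \<in> {p,q,u,v}" "g \<noteq> h" for g h
      using that \<open>{p,q,u,v} \<subseteq> V\<close> \<open>\<sigma> permutes V\<close>
      by (intro pm) (auto simp: permutes_in_image inj_eq[OF permutes_inj])
    from this[of p u] this[of q u] this[of p v] this[of q v] that(1,4)
    show ?thesis by (auto simp: alt4_def)
  qed
  have "(\<Sum>\<sigma>\<in>perms V. real (card {(i,j)\<in>P. bad \<sigma> i j}))
      = (\<Sum>\<sigma>\<in>perms V. \<Sum>(i,j)\<in>P. of_bool (bad \<sigma> i j))"
    using finP by (intro sum.cong refl) (simp add: case_prod_unfold Int_def)
  also have "\<dots> = (\<Sum>(i,j)\<in>P. \<Sum>\<sigma>\<in>perms V. of_bool (bad \<sigma> i j))"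
    by (subst sum.swap) (simp add: case_prod_unfold)
  also have "\<dots> \<le> (\<Sum>(i,j)\<in>P. 2 * D)"
  proof (intro sum_mono, clarify)
    fix i j assume ij: "(i, j) \<in> P"
    then have d: "distinct [i, b, j, a]" "{i, b, j, a} \<subseteq> V" "distinct [b, a, j, c]" "{b, a, j, c} \<subseteq> V"
      using abc by (auto simp: P_def)
    have "(\<Sum>\<sigma>\<in>perms V. of_bool (bad \<sigma> i j)) \<le> (\<Sum>\<sigma>\<in>perms V.
        \<bar>alt4 B (\<sigma> i) (\<sigma> b) (\<sigma> j) (\<sigma> a)\<bar> + \<bar>alt4 B (\<sigma> b) (\<sigma> a) (\<sigma> j) (\<sigma> c)\<bar>)"
    proof (rule sum_mono)
      fix \<sigma> assume "\<sigma> \<in> perms V"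
      then show "of_bool (bad \<sigma> i j) \<le>
        \<bar>alt4 B (\<sigma> i) (\<sigma> b) (\<sigma> j) (\<sigma> a)\<bar> + \<bar>alt4 B (\<sigma> b) (\<sigma> a) (\<sigma> j) (\<sigma> c)\<bar>"
        using one_le[OF d(1,2), of \<sigma>] one_le[OF d(3,4), of \<sigma>] by (auto simp: bad_def)
    qed
    also have "\<dots> = 2 * D" using D[OF d(1,2)] D[OF d(3,4)] by (simp add: sum.distrib)
    finally show "(\<Sum>\<sigma>\<in>perms V. of_bool (bad \<sigma> i j)) \<le> 2 * D" .
  qed
  also have "\<dots> = card P * (2 * D)" by (simp add: case_prod_unfold)
  also have "\<dots> \<le> ?n\<^sup>2 * (2 * D)"
    using card_mono[OF _ P] fin
    by (intro mult_right_mono) (auto simp: card_cartesian_product power2_eq_square D_def sum_nonneg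
       simp flip: of_nat_mult)
  finally have upper: "(\<Sum>\<sigma>\<in>perms V. real (card {(i,j)\<in>P. bad \<sigma> i j})) \<le> ?n\<^sup>2 * (2 * D)" .
  have lower: "?n\<^sup>2 / 200 \<le> real (card {(i,j)\<in>P. bad \<sigma> i j})" if \<sigma>: "\<sigma> permutes V" for \<sigma>
  proof (rule ccontr)
    assume neg: "\<not> ?thesis"
    have inj: "inj \<sigma>" using \<sigma> by (rule permutes_inj)
    let ?E = "{(x, y). x \<in> V - {\<sigma> a,\<sigma> b,\<sigma> c} \<and> y \<in> V - {\<sigma> a,\<sigma> b,\<sigma> c} \<and> x \<noteq> y \<and>
        (alt4 B x (\<sigma> b) y (\<sigma> a) \<noteq> 0 \<or> alt4 B (\<sigma> b) (\<sigma> a) y (\<sigma> c) \<noteq> 0)}"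
    have "?E \<subseteq> map_prod \<sigma> \<sigma> ` {(i,j)\<in>P. bad \<sigma> i j}"
    proof
      fix e assume "e \<in> ?E"
      then obtain x y where e: "e = (x, y)" and *: "x \<in> V" "x \<notin> {\<sigma> a,\<sigma> b,\<sigma> c}" "y \<in> V" "y \<notin> {\<sigma> a,\<sigma> b,\<sigma> c}" "x \<noteq> y"
        "alt4 B x (\<sigma> b) y (\<sigma> a) \<noteq> 0 \<or> alt4 B (\<sigma> b) (\<sigma> a) y (\<sigma> c) \<noteq> 0"
        by blast
      then obtain i j where ij: "x = \<sigma> i" "i \<in> V" "y = \<sigma> j" "j \<in> V"
        using permutes_image[OF \<sigma>] by (metis imageE)
      then have "(i, j) \<in> {(i,j)\<in>P. bad \<sigma> i j}" using * by (auto simp: P_def bad_def)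
      then show "e \<in> map_prod \<sigma> \<sigma> ` {(i,j)\<in>P. bad \<sigma> i j}"
        using ij e by (intro image_eqI[of _ _ "(i, j)"]) auto
    qed
    then have "card ?E \<le> card {(i,j)\<in>P. bad \<sigma> i j}"
      using finP by (intro surj_card_le) (auto intro: finite_subset)
    then have few: "real (card ?E) \<le> ?n\<^sup>2 / 200" using neg by linarith
    have abc': "distinct [\<sigma> a, \<sigma> b, \<sigma> c]" "{\<sigma> a, \<sigma> b, \<sigma> c} \<subseteq> V"
      using abc \<sigma> by (auto simp: inj_eq[OF inj] permutes_in_image)
    from nearly_constant[OF fin large B diag pm abc' few] small_mean show False by simp
  qed
  have "fact (card V) * (?n\<^sup>2 / 200) = (\<Sum>\<sigma>\<in>perms V. ?n\<^sup>2 / 200)"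
    using card_permutations[OF refl fin] by simp
  also have "\<dots> \<le> (\<Sum>\<sigma>\<in>perms V. real (card {(i,j)\<in>P. bad \<sigma> i j}))"
    by (intro sum_mono lower) simp
  also note upper
  finally have "?n\<^sup>2 * (fact (card V) / 400) \<le> ?n\<^sup>2 * D" by (simp add: algebra_simps)
  then show "fact (card V) / 400 \<le> (\<Sum>\<sigma>\<in>perms V. \<bar>alt4 B (\<sigma> w) (\<sigma> x) (\<sigma> y) (\<sigma> z)\<bar>)"
    using large unfolding D_def by (subst (asm) mult_le_cancel_left_pos) auto
qed

section \<open>Lower bounds for the signed edge sum\<close>

text \<open>The vertices u and v themselves are left out, so both adjacent and non-adjacent twins
  are covered.\<close>

definition twins :: "'a set \<Rightarrow> ('a \<Rightarrow> 'a \<Rightarrow> real) \<Rightarrow> 'a \<Rightarrow> 'a \<Rightarrow> bool" where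
  "twins V A u v \<longleftrightarrow> (\<forall>w\<in>V - {u, v}. A u w = A v w)"

text \<open>A neighbour \<open>w\<close> of one member of \<open>R\<close> is adjacent to every
  member other than \<open>w\<close> itself. The degree of \<open>w\<close> bounds their number, and
  the 1 accounts for \<open>w\<close> possibly lying in \<open>R\<close>.\<close>

lemma card_pairwise_twins_le:
  assumes fin: "finite V" and R: "R \<subseteq> V"
    and tw: "\<And>u v. u \<in> R \<Longrightarrow> v \<in> R \<Longrightarrow> u \<noteq> v \<Longrightarrow> twins V A u v"
    and A: "\<And>p q. A p q = A q p" and A01: "\<And>p q. A p q \<in> {0, 1}"
    and diag: "\<And>p. A p p = 0"
    and nonisolated: "\<And>u. u \<in> V \<Longrightarrow> (\<Sum>q\<in>V. A u q) \<noteq> 0"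
    and deg: "\<And>u. u \<in> V \<Longrightarrow> (\<Sum>q\<in>V. A u q) \<le> d"
    and V: "V \<noteq> {}"
  shows "real (card R) \<le> d + 1"
proof (cases "R = {}")
  have nonneg: "0 \<le> A p q" for p q using A01[of p q] by auto
  case True
  obtain u where "u \<in> V" using V by auto
  then have "0 \<le> d" using deg[of u] sum_nonneg[of V "A u"] nonneg by force
  then show ?thesis using True by simp
next
  have nonneg: "0 \<le> A p q" for p q using A01[of p q] by auto
  case False
  then obtain u where u: "u \<in> R" by auto
  then obtain w where w: "w \<in> V" "A u w \<noteq> 0" using nonisolated[of u] R by (meson subsetD sum.neutral)
  then have Auw: "A u w = 1" using A01[of u w] by auto
  have adj: "A w v = 1" if "v \<in> R - {w}" for v
  proof (cases "v = u")
    case False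
    have "w \<noteq> u" using w diag by auto
    then have "A u w = A v w" using tw[of u v] that u False w by (auto simp: twins_def)
    then show ?thesis using Auw A by metis
  qed (use Auw A in metis)
  have "real (card R) \<le> real (card (R - {w})) + 1"
    using card_Diff1_le[of R w] by (cases "w \<in> R") (use R fin finite_subset in \<open>auto simp: card_Diff_singleton\<close>)
  also have "real (card (R - {w})) = (\<Sum>v\<in>R - {w}. A w v)" using adj by simp
  also have "\<dots> \<le> (\<Sum>v\<in>V. A w v)"
    using R fin nonneg by (intro sum_mono2) auto
  also have "\<dots> \<le> d" using deg w by auto
  finally show ?thesis by simp
qed

text \<open>The non-twin pairs cover at least n - d - 1 vertices; a sixteenth of these have usable
  witnesses after the random splitting. Each contributes \<open>D\<close> on average to a sum
  bounded by 4\<open>K\<close>, whence 64 = 16 * 4.\<close>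

lemma form_large_of_alt4_large:
  fixes K D d :: real
  assumes fin: "finite V"
    and A: "\<And>p q. A p q = A q p" and A01: "\<And>p q. A p q \<in> {0, 1}"
    and diag: "\<And>p. A p p = 0"
    and nonisolated: "\<And>u. u \<in> V \<Longrightarrow> (\<Sum>q\<in>V. A u q) \<noteq> 0"
    and deg: "\<And>u. u \<in> V \<Longrightarrow> (\<Sum>q\<in>V. A u q) \<le> d"
    and d: "d < real (card V) - 2"
    and B: "\<And>x y. B x y = B y x"
    and abcd: "distinct [a, b, c, e]" "{a, b, c, e} \<subseteq> V"
    and alt: "fact (card V) * D \<le> (\<Sum>\<sigma>\<in>perms V. \<bar>alt4 B (\<sigma> a) (\<sigma> b) (\<sigma> c) (\<sigma> e)\<bar>)" and D: "0 \<le> D"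
    and bound: "\<And>\<pi>. \<pi> permutes V \<Longrightarrow> \<bar>signed_form V A B \<pi>\<bar> \<le> K"
  shows "(real (card V) - d - 1) * D \<le> 64 * K"
proof -
  let ?S = "\<Sum>\<sigma>\<in>perms V. \<bar>alt4 B (\<sigma> a) (\<sigma> b) (\<sigma> c) (\<sigma> e)\<bar>"
  obtain \<tau> where \<tau>: "\<tau> permutes V" "\<And>x. \<tau> (\<tau> x) = x" "\<And>p. \<tau> p \<noteq> p \<Longrightarrow> \<not> twins V A p (\<tau> p)"
    and max: "\<And>u v. u \<in> V \<Longrightarrow> v \<in> V \<Longrightarrow> u \<noteq> v \<Longrightarrow> \<tau> u = u \<Longrightarrow> \<tau> v = v \<Longrightarrow> twins V A u v"
  proof -
    have "twins V A v u" if "twins V A u v" for u v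
      using that unfolding twins_def by (metis insert_commute)
    then show thesis using maximal_pairing[OF fin, of "\<lambda>u v. \<not> twins V A u v"] that by metis
  qed
  define R where "R = {p\<in>V. \<tau> p = p}"
  define P where "P = {p\<in>V. \<tau> p \<noteq> p}"
  have "real (card R) \<le> d + 1"
    by (rule card_pairwise_twins_le[OF fin _ _ A A01 diag nonisolated deg])
      (use max abcd in \<open>auto simp: R_def\<close>)
  moreover have "card V = card R + card P"
    using fin unfolding R_def P_def
    by (subst card_Un_disjoint[symmetric]) (auto intro: arg_cong[where f = card])
  ultimately have cardP: "real (card V) - d - 1 \<le> card P" by simp
  define \<delta> where "\<delta> p q = A p q - A (\<tau> p) q" for p q
  \<comment> \<open>At \<open>w\<close> the rows of the pair differ; let \<open>x\<close> be the
    member adjacent to \<open>w\<close>. As d < n - 2, some \<open>w'\<close> outside the pair is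
    not adjacent to \<open>x\<close>. The row of \<open>x\<close> minus the row of its partner is 1
    at \<open>w\<close> and at most 0 at \<open>w'\<close>.\<close>
  have "\<exists>w w'. w \<in> V \<and> w' \<in> V \<and> w \<notin> {p, \<tau> p} \<and> w' \<notin> {p, \<tau> p} \<and> 1 \<le> \<bar>\<delta> p w - \<delta> p w'\<bar>"
    if "p \<in> P" for p
  proof -
    let ?W = "V - {p, \<tau> p}"
    have nonneg: "0 \<le> A r q" for r q using A01[of r q] by auto
    have pV: "p \<in> V" "\<tau> p \<in> V" "\<tau> p \<noteq> p" using that \<tau>(1) by (auto simp: P_def permutes_in_image)
    then obtain w where w: "w \<in> ?W" "A p w \<noteq> A (\<tau> p) w" using \<tau>(3)[of p] by (auto simp: twins_def)
    then obtain x y where xy: "{x, y} = {p, \<tau> p}" "A x w = 1" "A y w = 0"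
      using A01[of p w] A01[of "\<tau> p" w] by auto
    then have xy_cases: "(x = p \<and> y = \<tau> p) \<or> (x = \<tau> p \<and> y = p)" by (auto simp: doubleton_eq_iff)
    have "\<exists>w'\<in>?W. A x w' = 0"
    proof (rule ccontr)
      assume "\<not> ?thesis"
      then have "A x w' = 1" if "w' \<in> ?W" for w' using that A01[of x w'] by auto
      then have "real (card ?W) = (\<Sum>q\<in>?W. A x q)" by simp
      also have "\<dots> \<le> (\<Sum>q\<in>V. A x q)"
        using fin nonneg by (intro sum_mono2) auto
      also have "\<dots> \<le> d" using xy_cases pV by (intro deg) auto
      finally have "real (card ?W) \<le> d" .
      moreover have "card V \<le> card ?W + 2"
        using pV by (simp add: card_Diff_subset)
      ultimately show False using d by linarith
    qed
    then obtain w' where w': "w' \<in> ?W" "A x w' = 0" by auto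
    have "1 \<le> \<bar>\<delta> p w - \<delta> p w'\<bar>"
      using xy_cases xy(2,3) w'(2) A01[of y w'] by (auto simp: \<delta>_def)
    then show ?thesis using w w' by blast
  qed
  then obtain w w' where w: "\<And>p. p \<in> P \<Longrightarrow> w p \<in> V \<and> w' p \<in> V \<and> w p \<notin> {p, \<tau> p} \<and> w' p \<notin> {p, \<tau> p}
      \<and> 1 \<le> \<bar>\<delta> p (w p) - \<delta> p (w' p)\<bar>"
    by metis
  obtain X where X: "X \<subseteq> V"
    "card P \<le> 16 * card {p\<in>P. p \<in> X \<and> \<tau> p \<in> X \<and> w p \<notin> X \<and> w' p \<notin> X}"
    using exists_splitting_subset[OF fin, of P "\<lambda>p. p" \<tau> w w'] w \<tau>(1)
    by (auto simp: P_def permutes_in_image)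
  define good where "good = {p\<in>P. p \<in> X \<and> \<tau> p \<in> X \<and> w p \<notin> X \<and> w' p \<notin> X}"
  \<comment> \<open>Only pairs inside \<open>X\<close> are kept. For a good \<open>p\<close> both
    witnesses lie outside \<open>X\<close>, so they are unpaired, as
    \<open>sum_perms_swap_coeff_ge\<close> demands.\<close>
  define \<upsilon> where "\<upsilon> p = (if p \<in> X \<and> \<tau> p \<in> X then \<tau> p else p)" for p
  have uu: "\<upsilon> (\<upsilon> p) = p" for p by (auto simp: \<upsilon>_def \<tau>(2))
  have u: "\<upsilon> permutes V"
    by (rule involution_permutes[OF uu]) (use X in \<open>auto simp: \<upsilon>_def\<close>)
  have good: "?S \<le> (\<Sum>\<sigma>\<in>perms V. \<bar>swap_coeff V A B \<upsilon> \<sigma> p\<bar>)" if "p \<in> good" for p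
  proof (rule sum_perms_swap_coeff_ge[OF fin u uu _ _ _ _ _ _ abcd])
    have p: "p \<in> P" "p \<in> X" "\<tau> p \<in> X" "w p \<notin> X" "w' p \<notin> X" using that by (auto simp: good_def)
    then show "\<upsilon> (w p) = w p" "\<upsilon> (w' p) = w' p" "w p \<in> V" "w' p \<in> V" "\<upsilon> p \<noteq> p"
      "1 \<le> \<bar>(A p (w p) - A (\<upsilon> p) (w p)) - (A p (w' p) - A (\<upsilon> p) (w' p))\<bar>"
      using w[OF p(1)] by (auto simp: \<upsilon>_def P_def \<delta>_def)
  qed
  have finG: "finite good" "good \<subseteq> V" using fin by (auto simp: good_def P_def)
  have "real (card good) * (fact (card V) * D) \<le> real (card good) * ?S"
    using alt by (intro mult_left_mono) auto
  also have "\<dots> = (\<Sum>p\<in>good. ?S)" by simp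
  also have "\<dots> \<le> (\<Sum>p\<in>good. \<Sum>\<sigma>\<in>perms V. \<bar>swap_coeff V A B \<upsilon> \<sigma> p\<bar>)"
    by (intro sum_mono good)
  also have "\<dots> \<le> (\<Sum>p\<in>V. \<Sum>\<sigma>\<in>perms V. \<bar>swap_coeff V A B \<upsilon> \<sigma> p\<bar>)"
    using finG fin by (intro sum_mono2) (auto intro: sum_nonneg)
  also have "\<dots> = (\<Sum>\<sigma>\<in>perms V. \<Sum>p\<in>V. \<bar>swap_coeff V A B \<upsilon> \<sigma> p\<bar>)" by (rule sum.swap)
  also have "\<dots> \<le> (\<Sum>\<sigma>\<in>perms V. 4 * K)"
    by (intro sum_mono sum_swap_coeff_le[OF A B u uu _ bound]) auto
  also have "\<dots> = fact (card V) * (4 * K)" using card_permutations[OF refl fin] by simp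
  finally have "fact (card V) * (card good * D) \<le> fact (card V) * (4 * K)" by (simp add: algebra_simps)
  then have "card good * D \<le> 4 * K" by (subst (asm) mult_le_cancel_left_pos) auto
  moreover have "real (card V) - d - 1 \<le> 16 * real (card good)"
    using cardP X(2) unfolding good_def by linarith
  then have "(real (card V) - d - 1) * D \<le> 16 * real (card good) * D"
    using D by (intro mult_right_mono)
  ultimately show ?thesis by simp
qed

text \<open>A random placement sends every pair of distinct vertices to a uniformly random pair. The
  average of the form is therefore the number of ordered edges, at least n, times the mean colour,
  at least 1/2 in absolute value.\<close>

lemma form_large_of_mean_large:
  assumes fin: "finite V" and V: "card V \<ge> 2" and diagA: "\<And>p. A p p = 0"
    and diagB: "\<And>x. B x x = 0"
    and mean: "(real (card V))\<^sup>2 / 2 \<le> \<bar>\<Sum>x\<in>V. \<Sum>y\<in>V. B x y\<bar>"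
    and deg: "\<And>u. u \<in> V \<Longrightarrow> 1 \<le> (\<Sum>q\<in>V. A u q)"
    and bound: "\<And>\<pi>. \<pi> permutes V \<Longrightarrow> \<bar>signed_form V A B \<pi>\<bar> \<le> K"
  shows "real (card V) / 2 \<le> K"
proof -
  let ?n = "real (card V)"
  let ?B = "\<Sum>x\<in>V. \<Sum>y\<in>V. B x y"
  define S where "S p q = (\<Sum>\<sigma>\<in>perms V. B (\<sigma> p) (\<sigma> q))" for p q
  obtain a b where ab: "a \<in> V" "b \<in> V" "a \<noteq> b"
    using V by (metis card_le_Suc0_iff_eq fin not_less_eq_eq numeral_2_eq_2)
  have S: "S p q = (if p = q then 0 else S a b)" if "p \<in> V" "q \<in> V" for p q
    using sum_perms_list_eq[of "[p,q]" "[a,b]" V "\<lambda>l. B (l!0) (l!1)"] that ab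
    by (auto simp: S_def diagB)
  have "fact (card V) * ?B = (\<Sum>\<sigma>\<in>perms V. ?B)" using card_permutations[OF refl fin] by simp
  also have "\<dots> = (\<Sum>\<sigma>\<in>perms V. \<Sum>p\<in>V. \<Sum>q\<in>V. B (\<sigma> p) (\<sigma> q))"
  proof (rule sum.cong[OF refl])
    fix \<sigma> assume "\<sigma> \<in> perms V"
    then have \<sigma>: "\<sigma> permutes V" by simp
    show "?B = (\<Sum>p\<in>V. \<Sum>q\<in>V. B (\<sigma> p) (\<sigma> q))"
      using sum.permute[OF \<sigma>, of "\<lambda>x. \<Sum>y\<in>V. B x y"] sum.permute[OF \<sigma>, of "B _"]
      by (simp add: o_def)
  qed
  also have "\<dots> = (\<Sum>p\<in>V. \<Sum>q\<in>V. S p q)"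
    unfolding S_def by (subst sum.swap, rule sum.cong[OF refl], rule sum.swap)
  also have "\<dots> = (\<Sum>p\<in>V. \<Sum>q\<in>V. if p = q then 0 else S a b)" using S by simp
  also have "\<dots> = (\<Sum>p\<in>V. (?n - 1) * S a b)"
  proof (intro sum.cong refl)
    fix p assume "p \<in> V"
    then have "(\<Sum>q\<in>V. if p = q then 0 else S a b) = (\<Sum>q\<in>V - {p}. S a b)"
      using fin by (intro sum.mono_neutral_cong_right) auto
    then show "(\<Sum>q\<in>V. if p = q then 0 else S a b) = (?n - 1) * S a b"
      using fin \<open>p \<in> V\<close> V by (simp add: of_nat_diff)
  qed
  finally have total: "fact (card V) * ?B = ?n * ((?n - 1) * S a b)" by simp
  have "fact (card V) * (?n\<^sup>2 / 2) \<le> fact (card V) * \<bar>?B\<bar>" using mean by (intro mult_left_mono) auto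
  also have "\<dots> = \<bar>?n * ((?n - 1) * S a b)\<bar>" using total by (simp add: abs_mult flip: total)
  also have "\<dots> = ?n * ((?n - 1) * \<bar>S a b\<bar>)" using V by (simp add: abs_mult)
  also have "\<dots> \<le> ?n * (?n * \<bar>S a b\<bar>)" by (intro mult_left_mono mult_right_mono) auto
  finally have "?n\<^sup>2 * (fact (card V) / 2) \<le> ?n\<^sup>2 * \<bar>S a b\<bar>" by (simp add: power2_eq_square algebra_simps)
  then have Sab: "fact (card V) / 2 \<le> \<bar>S a b\<bar>" using V by (subst (asm) mult_le_cancel_left_pos) auto
  let ?A = "\<Sum>p\<in>V. \<Sum>q\<in>V. A p q"
  have "?n = (\<Sum>p\<in>V. 1)" by simp
  also have "\<dots> \<le> ?A" by (intro sum_mono deg)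
  finally have "?n * (fact (card V) / 2) \<le> ?A * \<bar>S a b\<bar>" using Sab by (intro mult_mono) auto
  also have "\<dots> \<le> \<bar>?A * S a b\<bar>" by (auto simp: abs_mult intro: mult_right_mono)
  also have "?A * S a b = (\<Sum>p\<in>V. \<Sum>q\<in>V. A p q * S p q)"
    unfolding sum_distrib_right using S by (intro sum.cong refl) (auto simp: diagA)
  also have "\<dots> = (\<Sum>p\<in>V. \<Sum>\<sigma>\<in>perms V. \<Sum>q\<in>V. A p q * B (\<sigma> p) (\<sigma> q))"
    unfolding S_def sum_distrib_left by (rule sum.cong[OF refl], rule sum.swap)
  also have "\<dots> = (\<Sum>\<sigma>\<in>perms V. signed_form V A B \<sigma>)" unfolding signed_form_def by (rule sum.swap)
  also have "\<bar>\<dots>\<bar> \<le> (\<Sum>\<sigma>\<in>perms V. \<bar>signed_form V A B \<sigma>\<bar>)" by (rule sum_abs)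
  also have "\<dots> \<le> (\<Sum>\<sigma>\<in>perms V. K)" by (intro sum_mono bound) auto
  also have "\<dots> = fact (card V) * K" using card_permutations[OF refl fin] by simp
  finally have "fact (card V) * (?n / 2) \<le> fact (card V) * K" by (simp add: algebra_simps)
  then show ?thesis by (subst (asm) mult_le_cancel_left_pos) auto
qed

section \<open>From edge sets to symmetric matrices\<close>

lemma sum_edges_eq:
  fixes h :: "nat set \<Rightarrow> real"
  assumes F: "F \<subseteq> Kn_edges n"
  shows "(\<Sum>p\<in>{0..<n}. \<Sum>q\<in>{0..<n}. of_bool ({p, q} \<in> F) * h {p, q}) = 2 * (\<Sum>e\<in>F. h e)"
proof -
  let ?V = "{0..<n}"
  define T where "T = {(p, q)\<in>?V \<times> ?V. {p, q} \<in> F}"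
  have finF: "finite F"
    by (rule finite_subset[of _ "Pow ?V"]) (use F in \<open>auto simp: Kn_edges_def\<close>)
  have finT: "finite T" by (rule finite_subset[of _ "?V \<times> ?V"]) (auto simp: T_def)
  have fibre: "(\<Sum>x\<in>{x \<in> T. (case x of (p, q) \<Rightarrow> {p, q}) = e}. h (case x of (p, q) \<Rightarrow> {p, q})) = 2 * h e"
    if e: "e \<in> F" for e
  proof -
    obtain a b where ab: "e = {a, b}" "a \<noteq> b" "a < n" "b < n"
      using e F by (auto simp: Kn_edges_def card_2_iff)
    have "{x \<in> T. (case x of (p, q) \<Rightarrow> {p, q}) = e} = {(a, b), (b, a)}"
      using ab e by (auto simp: T_def doubleton_eq_iff insert_commute)
    then show ?thesis using ab by (simp add: insert_commute)
  qed
  have "(\<Sum>p\<in>?V. \<Sum>q\<in>?V. of_bool ({p, q} \<in> F) * h {p, q}) =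
      (\<Sum>x\<in>?V \<times> ?V. of_bool (x \<in> T) * h (case x of (p, q) \<Rightarrow> {p, q}))"
    unfolding sum.cartesian_product by (intro sum.cong) (auto simp: T_def)
  also have "\<dots> = (\<Sum>x\<in>T. h (case x of (p, q) \<Rightarrow> {p, q}))"
    by (rule sum.mono_neutral_cong_right) (auto simp: T_def)
  also have "\<dots> = (\<Sum>e\<in>F. \<Sum>x\<in>{x \<in> T. (case x of (p, q) \<Rightarrow> {p, q}) = e}.
      h (case x of (p, q) \<Rightarrow> {p, q}))"
    by (rule sum.group[OF finT finF, symmetric]) (auto simp: T_def)
  also have "\<dots> = (\<Sum>e\<in>F. 2 * h e)" by (rule sum.cong[OF refl fibre])
  finally show ?thesis by (simp add: sum_distrib_left)
qed

lemma degree_eq_sum: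
  assumes F: "F \<subseteq> Kn_edges n"
  shows "real (degree F u) = (\<Sum>q\<in>{0..<n}. of_bool ({u, q} \<in> F))"
proof -
  have "{e\<in>F. u \<in> e} = (\<lambda>q. {u, q}) ` {q\<in>{0..<n}. {u, q} \<in> F}"
  proof (intro equalityI subsetI)
    fix e assume "e \<in> {e\<in>F. u \<in> e}"
    then show "e \<in> (\<lambda>q. {u, q}) ` {q\<in>{0..<n}. {u, q} \<in> F}"
      using F by (fastforce simp: Kn_edges_def card_2_iff insert_commute)
  qed auto
  moreover have "inj_on (\<lambda>q. {u, q}) {q\<in>{0..<n}. {u, q} \<in> F}"
    by (auto simp: inj_on_def doubleton_eq_iff)
  ultimately show ?thesis by (simp add: degree_def card_image Int_def)
qed

lemma discrepancy_copy_eq: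
  assumes F: "F \<subseteq> Kn_edges n" and \<sigma>: "\<sigma> permutes {0..<n}"
  shows "2 * real_of_int (discrepancy f (copy_edges \<sigma> F)) =
    \<bar>signed_form {0..<n} (\<lambda>p q. of_bool ({p, q} \<in> F)) (\<lambda>x y. if x = y then 0 else real_of_int (f {x, y})) \<sigma>\<bar>"
proof -
  have inj: "inj \<sigma>" using \<sigma> by (rule permutes_inj)
  then have "inj_on ((`) \<sigma>) F" by (auto simp: inj_on_def inj_image_eq_iff)
  then have "discrepancy f (copy_edges \<sigma> F) = \<bar>\<Sum>e\<in>F. f (\<sigma> ` e)\<bar>"
    by (simp add: discrepancy_def copy_edges_def sum.reindex)
  moreover have "signed_form {0..<n} (\<lambda>p q. of_bool ({p, q} \<in> F)) (\<lambda>x y. if x = y then 0 else real_of_int (f {x, y})) \<sigma>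
      = (\<Sum>p\<in>{0..<n}. \<Sum>q\<in>{0..<n}. of_bool ({p, q} \<in> F) * real_of_int (f (\<sigma> ` {p, q})))"
    unfolding signed_form_def using F
    by (intro sum.cong refl) (auto simp: Kn_edges_def inj_eq[OF inj])
  ultimately show ?thesis using sum_edges_eq[OF F, of "\<lambda>e. real_of_int (f (\<sigma> ` e))"] by simp
qed

lemma exists_large_discrepancy:
  fixes \<epsilon> :: real
  assumes \<epsilon>: "0 < \<epsilon>" and large: "200 \<le> n" "3 / \<epsilon> \<le> real n" and F: "F \<subseteq> Kn_edges n"
    and deg: "\<And>v. v < n \<Longrightarrow> real (degree F v) \<le> (1 - \<epsilon>) * real n"
    and nonisolated: "\<And>v. v < n \<Longrightarrow> degree F v \<noteq> 0"
    and f: "\<And>e. e \<in> Kn_edges n \<Longrightarrow> f e = 1 \<or> f e = (-1 :: int)"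
  shows "\<exists>\<sigma>. bij_betw \<sigma> {0..<n} {0..<n} \<and>
    real_of_int (discrepancy f (copy_edges \<sigma> F)) \<ge> 1 / 102400 * \<epsilon> * real n"
proof (rule ccontr)
  assume none: "\<not> ?thesis"
  let ?V = "{0..<n}"
  define A where "A p q = (of_bool ({p, q} \<in> F) :: real)" for p q
  define B where "B x y = (if x = y then 0 else real_of_int (f {x, y}))" for x y
  define K where "K = 1 / 51200 * \<epsilon> * real n"
  have A: "A p q = A q p" and B: "B p q = B q p" for p q by (simp_all add: A_def B_def insert_commute)
  have A01: "A p q \<in> {0, 1}" for p q by (simp add: A_def)
  have diag: "A p p = 0" "B p p = 0" for p using F by (auto simp: A_def B_def Kn_edges_def)
  have pm: "B x y = 1 \<or> B x y = -1" if "x \<in> ?V" "y \<in> ?V" "x \<noteq> y" for x y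
    using f[of "{x, y}"] that by (auto simp: B_def Kn_edges_def)
  have degA: "(\<Sum>q\<in>?V. A u q) = real (degree F u)" for u
    using degree_eq_sum[OF F, of u] by (simp add: A_def)
  have bound: "\<bar>signed_form ?V A B \<sigma>\<bar> < K" if \<sigma>: "\<sigma> permutes ?V" for \<sigma>
  proof -
    have "real_of_int (discrepancy f (copy_edges \<sigma> F)) < 1 / 102400 * \<epsilon> * real n"
      using none permutes_imp_bij[OF \<sigma>] by (auto simp: not_le)
    moreover have "\<bar>signed_form ?V A B \<sigma>\<bar> = 2 * real_of_int (discrepancy f (copy_edges \<sigma> F))"
      using discrepancy_copy_eq[OF F \<sigma>, of f] by (simp add: A_def[abs_def] B_def[abs_def])
    ultimately show ?thesis by (simp add: K_def)
  qed
  have "real (degree F 0) \<le> (1 - \<epsilon>) * real n" using deg large by auto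
  then have "\<epsilon> * real n \<le> real n" by (simp add: algebra_simps)
  have \<epsilon>n: "3 \<le> \<epsilon> * real n" using large(2) \<epsilon> by (simp add: field_simps)
  have abcd: "distinct [0, 1, 2, 3 :: nat]" "{0, 1, 2, 3} \<subseteq> ?V" using large(1) by auto
  from alt4_or_mean_large[of ?V B, OF _ _ B diag(2) pm abcd] large(1)
  consider "fact n / 400 \<le> (\<Sum>\<sigma>\<in>perms ?V. \<bar>alt4 B (\<sigma> 0) (\<sigma> 1) (\<sigma> 2) (\<sigma> 3)\<bar>)"
    | "(real n)\<^sup>2 / 2 \<le> \<bar>\<Sum>x\<in>?V. \<Sum>y\<in>?V. B x y\<bar>" by auto
  then show False
  proof cases
    case 1
    have "(real (card ?V) - (1 - \<epsilon>) * real n - 1) * (1 / 400) \<le> 64 * K"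
    proof (rule form_large_of_alt4_large[of ?V A _ B 0 1 2 3])
      show "fact (card ?V) * (1 / 400) \<le> (\<Sum>\<sigma>\<in>perms ?V. \<bar>alt4 B (\<sigma> 0) (\<sigma> 1) (\<sigma> 2) (\<sigma> 3)\<bar>)"
        using 1 by simp
      show "\<bar>signed_form ?V A B \<sigma>\<bar> \<le> K" if "\<sigma> permutes ?V" for \<sigma>
        using bound[OF that] by simp
      show "(1 - \<epsilon>) * real n < real (card ?V) - 2" using \<epsilon>n by (simp add: algebra_simps)
    qed (use A B A01 diag degA deg nonisolated abcd in auto)
    then have "\<epsilon> * real n - 1 \<le> 25600 * K" by (simp add: algebra_simps)
    then show False using \<epsilon>n by (simp add: K_def)
  next
    case 2
    have "real (card ?V) / 2 \<le> K"
    proof (rule form_large_of_mean_large[of ?V A B])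
      show "1 \<le> (\<Sum>q\<in>?V. A u q)" if "u \<in> ?V" for u
        using nonisolated[of u] that unfolding degA by simp
    qed (use large(1) diag 2 bound in \<open>auto intro: less_imp_le\<close>)
    then show False using \<open>\<epsilon> * real n \<le> real n\<close> large(1) by (simp add: K_def)
  qed
qed

theorem theorem1p1:
  shows "\<exists>c::real > 0. \<forall>\<epsilon>::real > 0. \<exists>n0::nat. \<forall>n \<ge> n0.
    \<forall>F. F \<subseteq> Kn_edges n
      \<longrightarrow> (\<forall>v < n. real (degree F v) \<le> (1 - \<epsilon>) * real n)
      \<longrightarrow> (\<forall>v < n. degree F v \<noteq> 0)
      \<longrightarrow> (\<forall>f :: nat set \<Rightarrow> int. (\<forall>e \<in> Kn_edges n. f e = 1 \<or> f e = -1)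
        \<longrightarrow> (\<exists>\<sigma>. bij_betw \<sigma> {0..<n} {0..<n} \<and>
              real_of_int (discrepancy f (copy_edges \<sigma> F)) \<ge> c * \<epsilon> * real n))"
proof (intro exI[of _ "1 / 102400"] conjI allI impI)
  fix \<epsilon> :: real assume \<epsilon>: "0 < \<epsilon>"
  have large: "200 \<le> n" "3 / \<epsilon> \<le> real n" if "max 200 (nat \<lceil>3 / \<epsilon>\<rceil>) \<le> n" for n
    using that by (auto simp: nat_ceiling_le_eq)
  show "\<exists>n0::nat. \<forall>n \<ge> n0. \<forall>F. F \<subseteq> Kn_edges n
      \<longrightarrow> (\<forall>v < n. real (degree F v) \<le> (1 - \<epsilon>) * real n)
      \<longrightarrow> (\<forall>v < n. degree F v \<noteq> 0)
      \<longrightarrow> (\<forall>f :: nat set \<Rightarrow> int. (\<forall>e \<in> Kn_edges n. f e = 1 \<or> f e = -1)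
        \<longrightarrow> (\<exists>\<sigma>. bij_betw \<sigma> {0..<n} {0..<n} \<and>
              real_of_int (discrepancy f (copy_edges \<sigma> F)) \<ge> 1 / 102400 * \<epsilon> * real n))"
    by (intro exI[of _ "max 200 (nat \<lceil>3 / \<epsilon>\<rceil>)"] allI impI exists_large_discrepancy[OF \<epsilon> large]) auto
qed simp

end
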